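(* Let $\Gamma=\Gamma_1\sqcup\Gamma_2$ be a disjoint union of two finite graphs, let $G\leq\mathrm{Aut}(\Gamma)$, and suppose that $G$ preserves both components, i.e. every $g\in G$ maps $V(\Gamma_1)$ to itself and $V(\Gamma_2)$ to itself. For $g\in G$ let $c_G(g):=\sum_{H\leq G,\ g\in H}\frac{1}{|H|}$. Then $$F_{\Gamma_1\sqcup\Gamma_2}(G;x,y)=\sum_{g\in G}c_G(g)\,P_{\Gamma_1/g}(x,y)\,P_{\Gamma_2/g}(x,y).$$
   Context: Graphs are finite and undirected; loops are allowed and parallel edges are irrelevant (only adjacency matters). For a graph $\Lambda$, the bivariate chromatic polynomial $P_\Lambda(x,y)$ (Dohmen–Pönitz–Tittmann) is the unique polynomial in $x,y$ such that, for all integers $x\ge y\ge 0$, $P_\Lambda(x,y)$ is the number of maps $c:V(\Lambda)\to\{1,\dots,x\}$ such that for every edge $uv$ of $\Lambda$ (including loops, $u=v$) with $c(u)=c(v)$ one has $c(u)>y$. Thus colours $1,\dots,y$ are "proper", colours $y+1,\dots,x$ are "improper", and a vertex carrying a loop can only receive an improper colour. For a graph $\Lambda$ on which $g$ acts as an automorphism, the quotient graph $\Lambda/g$ has as vertices the $\langle g\rangle$-orbits on $V(\Lambda)$; two distinct orbits are adjacent iff at least one edge of $\Lambda$ joins them, and an orbit carries a loop iff some edge of $\Lambda$ has both endpoints in that orbit. In $\Gamma_i/g$, the element $g$ acts on $\Gamma_i$ by restriction. The multiorbital bivariate chromatic polynomial of $\Gamma$ relative to $G$ is $$F_\Gamma(G;x,y):=\sum_{H\le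 G}\frac1{|H|}\sum_{h\in H}P_{\Gamma/h}(x,y),$$ the outer sum being over all subgroups $H$ of $G$. The sum defining $c_G(g)$ ranges over all subgroups $H$ of $G$ containing $g$. Identities are identities of polynomials in $x,y$ with rational coefficients. *)

theory Defs
  imports
    "HOL-Algebra.Bij"
    "HOL-Algebra.Generated_Groups"
    "HOL-Algebra.Group_Action"
    "HOL-Computational_Algebra.Polynomial"
    "Graph_Theory.Pair_Digraph"
begin

text \<open>
  A finite undirected graph with loops and without parallel edges is a
  \<^locale>\<open>pair_pseudo_graph\<close>: the edge \<open>uv\<close> is the pair of arcs \<open>(u, v)\<close>, \<open>(v, u)\<close>,
  and a loop at \<open>v\<close> is the arc \<open>(v, v)\<close>.
\<close>

definition graph_union :: "'a pair_pre_digraph \<Rightarrow> 'a pair_pre_digraph \<Rightarrow> 'a pair_pre_digraph"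
  where "graph_union \<Gamma>1 \<Gamma>2 =
    \<lparr>pverts = pverts \<Gamma>1 \<union> pverts \<Gamma>2, parcs = parcs \<Gamma>1 \<union> parcs \<Gamma>2\<rparr>"

text \<open>
  Automorphisms are extensional on the vertex set. An automorphism \<open>g\<close> of a union that
  preserves the vertex set \<open>W\<close> of one of the two graphs therefore induces the
  automorphism \<open>restrict g W\<close> of that graph, not \<open>g\<close> itself.
\<close>

definition graph_auto :: "'a pair_pre_digraph \<Rightarrow> ('a \<Rightarrow> 'a) set"
  where "graph_auto \<Lambda> = {f \<in> Bij (pverts \<Lambda>).
    \<forall>u\<in>pverts \<Lambda>. \<forall>v\<in>pverts \<Lambda>. (f u, f v) \<in> parcs \<Lambda> \<longleftrightarrow> (u, v) \<in> parcs \<Lambda>}"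

definition GraphAutoGroup :: "'a pair_pre_digraph \<Rightarrow> ('a \<Rightarrow> 'a) monoid"
  where "GraphAutoGroup \<Lambda> = BijGroup (pverts \<Lambda>) \<lparr>carrier := graph_auto \<Lambda>\<rparr>"

definition cyclic_orbits :: "'a pair_pre_digraph \<Rightarrow> ('a \<Rightarrow> 'a) \<Rightarrow> 'a set set"
  where "cyclic_orbits \<Lambda> g =
    orbits (GraphAutoGroup \<Lambda> \<lparr>carrier := generate (GraphAutoGroup \<Lambda>) {g}\<rparr>)
      (pverts \<Lambda>) (\<lambda>h. h)"

text \<open>The arcs with \<open>A = B\<close> are the loops of the quotient.\<close>

definition quotient_graph :: "'a pair_pre_digraph \<Rightarrow> ('a \<Rightarrow> 'a) \<Rightarrow> 'a set pair_pre_digraph"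
  where "quotient_graph \<Lambda> g =
    \<lparr>pverts = cyclic_orbits \<Lambda> g,
     parcs = {(A, B). A \<in> cyclic_orbits \<Lambda> g \<and> B \<in> cyclic_orbits \<Lambda> g \<and>
                      (\<exists>u\<in>A. \<exists>v\<in>B. (u, v) \<in> parcs \<Lambda>)}\<rparr>"

text \<open>
  Polynomials in \<open>x\<close>, \<open>y\<close> are elements of \<open>\<rat>[y][x]\<close>: the outer indeterminate is \<open>x\<close>,
  the inner one is \<open>y\<close>.
\<close>

definition poly2 :: "'a::comm_semiring_0 poly poly \<Rightarrow> 'a \<Rightarrow> 'a \<Rightarrow> 'a"
  where "poly2 p x y = poly (poly p [:x:]) y"

definition bicolourings :: "'a pair_pre_digraph \<Rightarrow> nat \<Rightarrow> nat \<Rightarrow> ('a \<Rightarrow> nat) set"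
  where "bicolourings \<Lambda> x y =
    {c \<in> pverts \<Lambda> \<rightarrow>\<^sub>E {1..x}. \<forall>(u, v)\<in>parcs \<Lambda>. c u = c v \<longrightarrow> c u > y}"

definition bichromatic_poly :: "'a pair_pre_digraph \<Rightarrow> rat poly poly"
  where "bichromatic_poly \<Lambda> = (THE p. \<forall>x y. y \<le> x \<longrightarrow>
    poly2 p (of_nat x) (of_nat y) = of_nat (card (bicolourings \<Lambda> x y)))"

definition multiorbital_bichromatic_poly ::
    "'a pair_pre_digraph \<Rightarrow> ('a \<Rightarrow> 'a) set \<Rightarrow> rat poly poly"
  where "multiorbital_bichromatic_poly \<Gamma> G =
    (\<Sum>H | subgroup H (GraphAutoGroup \<Gamma> \<lparr>carrier := G\<rparr>).
      smult [:1 / of_nat (card H):] (\<Sum>h\<in>H. bichromatic_poly (quotient_graph \<Gamma> h)))"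

definition orbital_weight :: "'a pair_pre_digraph \<Rightarrow> ('a \<Rightarrow> 'a) set \<Rightarrow> ('a \<Rightarrow> 'a) \<Rightarrow> rat"
  where "orbital_weight \<Gamma> G g =
    (\<Sum>H | subgroup H (GraphAutoGroup \<Gamma> \<lparr>carrier := G\<rparr>) \<and> g \<in> H. 1 / of_nat (card H))"

lemma poly2_simps [simp]:
  fixes p q :: "'a::comm_ring_1 poly poly"
  shows "poly2 (p + q) x y = poly2 p x y + poly2 q x y"
    "poly2 (p - q) x y = poly2 p x y - poly2 q x y"
    "poly2 (p * q) x y = poly2 p x y * poly2 q x y"
    "poly2 1 x y = 1" "poly2 0 x y = 0"
    "poly2 [:0, 1:] x y = x" "poly2 [:[:0, 1:]:] x y = y"
  by (simp_all add: poly2_def)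

lemma poly2_prod: "poly2 (prod f A) x y = (\<Prod>a\<in>A. poly2 (f a) x (y::'a::comm_ring_1))"
  by (induction A rule: infinite_finite_induct) simp_all

lemma poly2_eq_0:
  fixes p :: "rat poly poly"
  assumes "\<And>x y::nat. y \<le> x \<Longrightarrow> poly2 p (of_nat x) (of_nat y) = 0"
  shows "p = 0"
proof (rule poly_eqI)
  fix n
  have ev: "poly2 p x y = poly (map_poly (\<lambda>c. poly c y) p) x" for x y
    by (induction p) (auto simp: poly2_def map_poly_pCons)
  have inf: "infinite (of_nat ` {m::nat..} :: rat set)" for m
    by (subst finite_image_iff) (auto simp: inj_on_def infinite_Ici)
  have "poly (coeff p n) (of_nat m) = 0" for m :: nat
  proof -
    have "map_poly (\<lambda>c. poly c (of_nat m)) p = 0"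
    proof (rule ccontr)
      assume "map_poly (\<lambda>c. poly c (of_nat m)) p \<noteq> 0"
      then have "finite {x. poly (map_poly (\<lambda>c. poly c (of_nat m)) p) x = 0}"
        by (rule poly_roots_finite)
      moreover have "of_nat ` {m..} \<subseteq> {x. poly (map_poly (\<lambda>c. poly c (of_nat m)) p) x = 0}"
        using assms[of m] by (auto simp: ev)
      ultimately show False using inf[of m] finite_subset by blast
    qed
    then have "coeff (map_poly (\<lambda>c. poly c (of_nat m)) p) n = 0" by simp
    then show ?thesis by (simp add: coeff_map_poly)
  qed
  then have "of_nat ` {0..} \<subseteq> {x. poly (coeff p n) x = 0}" by auto
  then have "coeff p n = 0"
    using poly_roots_finite[of "coeff p n"] inf[of 0] finite_subset by blast
  then show "coeff p n = coeff 0 n" by simp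
qed

lemma count_constant_colourings:
  fixes V :: "'a set"
  assumes "finite V" "A \<subseteq> V \<times> V" "Y \<subseteq> V"
  shows "\<exists>p :: rat poly poly. \<forall>x y. y \<le> x \<longrightarrow> poly2 p (of_nat x) (of_nat y) =
    of_nat (card {c \<in> V \<rightarrow>\<^sub>E {1..x}. (\<forall>(u, v)\<in>A. c u = c v) \<and> (\<forall>v\<in>Y. c v \<le> y)})"
  using assms
proof (induction "card V" arbitrary: V A Y rule: less_induct)
  case less
  show ?case
  proof (cases "A \<subseteq> Id")
    case True
    have "{c \<in> V \<rightarrow>\<^sub>E {1..x}. (\<forall>(u, v)\<in>A. c u = c v) \<and> (\<forall>v\<in>Y. c v \<le> y)} =
        PiE V (\<lambda>v. if v \<in> Y then {1..y} else {1..x})" (is "?L = ?R")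
      if "y \<le> x" for x y :: nat
    proof (rule Set.set_eqI)
      fix c :: "'a \<Rightarrow> nat"
      have "\<forall>(u, v)\<in>A. c u = c v" using True by auto
      moreover have "(\<forall>v\<in>V. c v \<in> (if v \<in> Y then {1..y} else {1..x})) \<longleftrightarrow>
          (\<forall>v\<in>V. c v \<in> {1..x}) \<and> (\<forall>v\<in>Y. c v \<le> y)"
        using that less.prems(3) by (auto simp: subset_iff)
      ultimately show "c \<in> ?L \<longleftrightarrow> c \<in> ?R" unfolding PiE_iff by blast
    qed
    then show ?thesis
      by (intro exI[of _ "\<Prod>v\<in>V. if v \<in> Y then [:[:0, 1:]:] else [:0, 1:]"])
         (auto simp: poly2_prod card_PiE less.prems(1) intro!: prod.cong)
  next
    case False
    then obtain a b where ab: "(a, b) \<in> A" "a \<noteq> b" by auto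
    then have abV: "a \<in> V" "b \<in> V" using less.prems(2) by auto
    define r where "r = (\<lambda>v. if v = b then a else v)"
    define V' where "V' = V - {b}"
    define A' where "A' = (\<lambda>(u, v). (r u, r v)) ` A"
    define Y' where "Y' = r ` Y"
    have rV: "r v \<in> V'" if "v \<in> V" for v using that abV ab by (auto simp: r_def V'_def)
    have rid: "r v = v" if "v \<in> V'" for v using that by (auto simp: r_def V'_def)
    have "card V' < card V" unfolding V'_def
      by (rule card_Diff1_less[OF less.prems(1) abV(2)])
    moreover have "finite V'" "A' \<subseteq> V' \<times> V'" "Y' \<subseteq> V'"
      using less.prems rV by (auto simp: V'_def A'_def Y'_def)
    ultimately obtain p :: "rat poly poly" where p: "\<And>x y. y \<le> x \<Longrightarrow>
        poly2 p (of_nat x) (of_nat y) = of_nat (card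
          {c \<in> V' \<rightarrow>\<^sub>E {1..x}. (\<forall>(u, v)\<in>A'. c u = c v) \<and> (\<forall>v\<in>Y'. c v \<le> y)})"
      using less.hyps[of V' A' Y'] by blast
    have "card {c \<in> V \<rightarrow>\<^sub>E {1..x}. (\<forall>(u, v)\<in>A. c u = c v) \<and> (\<forall>v\<in>Y. c v \<le> y)} =
      card {c \<in> V' \<rightarrow>\<^sub>E {1..x}. (\<forall>(u, v)\<in>A'. c u = c v) \<and> (\<forall>v\<in>Y'. c v \<le> y)}"
      (is "card ?L = card ?R") for x y :: nat
    proof (rule bij_betw_same_card[of "\<lambda>c. restrict c V'"], rule bij_betw_byWitness)
      have cr: "c (r v) = c v" if "c \<in> ?L" for c v
        using that ab by (auto simp: r_def)
      show "\<forall>c\<in>?L. (\<lambda>v\<in>V. restrict c V' (r v)) = c"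
      proof (intro ballI ext)
        fix c v assume c: "c \<in> ?L"
        show "(\<lambda>v\<in>V. restrict c V' (r v)) v = c v"
        proof (cases "v \<in> V")
          case True
          then show ?thesis using rV[OF True] cr[OF c, of v] by simp
        next
          case False
          then show ?thesis using c by (auto simp: PiE_iff extensional_def)
        qed
      qed
      show "\<forall>c\<in>?R. restrict (\<lambda>v\<in>V. c (r v)) V' = c"
        by (auto simp: fun_eq_iff rid PiE_iff extensional_def restrict_def V'_def r_def)
      show "(\<lambda>c. restrict c V') ` ?L \<subseteq> ?R"
      proof (rule image_subsetI)
        fix c assume c: "c \<in> ?L"
        have 1: "restrict c V' (r v) = c v" if "v \<in> V" for v
          using that cr[OF c] rV by simp
        have "restrict c V' \<in> V' \<rightarrow>\<^sub>E {1..x}" using c by (auto simp: V'_def)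
        moreover have "restrict c V' (r u) = restrict c V' (r v)" if "(u, v) \<in> A" for u v
        proof -
          have "u \<in> V" "v \<in> V" "c u = c v" using that c less.prems(2) by auto
          then show ?thesis by (simp only: 1)
        qed
        then have "\<forall>(u, v)\<in>A'. restrict c V' u = restrict c V' v"
          by (auto simp: A'_def simp del: restrict_apply)
        moreover have "\<forall>v\<in>Y'. restrict c V' v \<le> y"
        proof
          fix w assume "w \<in> Y'"
          then obtain v where "v \<in> Y" "w = r v" by (auto simp: Y'_def)
          moreover have "c v \<le> y" using c \<open>v \<in> Y\<close> by auto
          ultimately show "restrict c V' w \<le> y" using 1[of v] less.prems(3) by auto
        qed
        ultimately show "restrict c V' \<in> ?R" by simp
      qed
      show "(\<lambda>c. \<lambda>v\<in>V. c (r v)) ` ?R \<subseteq> ?L"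
      proof (rule image_subsetI)
        fix c assume c: "c \<in> ?R"
        have "(\<lambda>v\<in>V. c (r v)) \<in> V \<rightarrow>\<^sub>E {1..x}" using c rV by auto
        moreover have "c (r u) = c (r v)" if "(u, v) \<in> A" for u v
          using c that by (auto simp: A'_def)
        moreover have "c (r v) \<le> y" if "v \<in> Y" for v
          using c that by (auto simp: Y'_def)
        ultimately show "(\<lambda>v\<in>V. c (r v)) \<in> ?L"
          using less.prems(2,3) by (auto simp: subset_iff)
      qed
    qed
    then show ?thesis using p by (intro exI[of _ p]) simp
  qed
qed

lemma count_bicolourings:
  assumes "finite E" "finite V" "E \<subseteq> V \<times> V" "A \<subseteq> V \<times> V" "Y \<subseteq> V"
  shows "\<exists>p :: rat poly poly. \<forall>x y. y \<le> x \<longrightarrow> poly2 p (of_nat x) (of_nat y) =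
    of_nat (card {c \<in> V \<rightarrow>\<^sub>E {1..x}. (\<forall>(u, v)\<in>A. c u = c v) \<and> (\<forall>v\<in>Y. c v \<le> y) \<and>
      (\<forall>(u, v)\<in>E. c u = c v \<longrightarrow> c u > y)})"
  using assms
proof (induction E arbitrary: A Y rule: finite_induct)
  case empty
  then show ?case using count_constant_colourings[of V A Y] by simp
next
  case (insert e E)
  obtain a b where e: "e = (a, b)" by fastforce
  let ?S = "\<lambda>E A Y x y. {c \<in> V \<rightarrow>\<^sub>E {1..x::nat}. (\<forall>(u, v)\<in>A. c u = c v) \<and>
    (\<forall>v\<in>Y. c v \<le> (y::nat)) \<and> (\<forall>(u, v)\<in>E. c u = c v \<longrightarrow> c u > y)}"
  obtain p :: "rat poly poly" where p: "\<And>x y. y \<le> x \<Longrightarrow>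
      poly2 p (of_nat x) (of_nat y) = of_nat (card (?S E A Y x y))"
    using insert.IH[of A Y] insert.prems by auto
  obtain q :: "rat poly poly" where q: "\<And>x y. y \<le> x \<Longrightarrow> poly2 q (of_nat x) (of_nat y) =
      of_nat (card (?S E (insert (a, b) A) (insert a Y) x y))"
    using insert.IH[of "insert (a, b) A" "insert a Y"] insert.prems e by auto
  have "of_nat (card (?S (insert e E) A Y x y)) =
      (of_nat (card (?S E A Y x y)) :: rat) -
      of_nat (card (?S E (insert (a, b) A) (insert a Y) x y))" for x y
  proof -
    have fin: "finite (?S E' A' Y' x y)" for E' A' Y'
      by (rule finite_subset[OF _ finite_PiE[OF insert.prems(1), of "\<lambda>_. {1..x}"]]) auto
    have "?S E A Y x y = ?S (insert e E) A Y x y \<union> ?S E (insert (a, b) A) (insert a Y) x y"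
      by (auto simp: e not_less)
    moreover have
      "?S (insert e E) A Y x y \<inter> ?S E (insert (a, b) A) (insert a Y) x y = {}"
      by (auto simp: e)
    ultimately have "card (?S E A Y x y) = card (?S (insert e E) A Y x y) +
        card (?S E (insert (a, b) A) (insert a Y) x y)"
      by (simp only: card_Un_disjoint[OF fin fin])
    then show ?thesis by simp
  qed
  then show ?case using p q by (intro exI[of _ "p - q"]) simp
qed

theorem bichromatic_poly_unique_existence:
  assumes "pair_pseudo_graph \<Lambda>"
  shows "\<exists>!p :: rat poly poly. \<forall>x y. y \<le> x \<longrightarrow>
    poly2 p (of_nat x) (of_nat y) = of_nat (card (bicolourings \<Lambda> x y))"
proof -
  interpret pair_pseudo_graph \<Lambda> by fact
  have "parcs \<Lambda> \<subseteq> pverts \<Lambda> \<times> pverts \<Lambda>"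
    using arc_fst_in_verts arc_snd_in_verts by force
  then have "\<exists>p :: rat poly poly. \<forall>x y. y \<le> x \<longrightarrow>
      poly2 p (of_nat x) (of_nat y) = of_nat (card (bicolourings \<Lambda> x y))"
    using count_bicolourings[of "parcs \<Lambda>" "pverts \<Lambda>" "{}" "{}"]
      pair_finite_verts pair_finite_arcs
    by (simp add: bicolourings_def)
  moreover have "p = q"
    if "\<forall>x y. y \<le> x \<longrightarrow> poly2 p (of_nat x) (of_nat y) = of_nat (card (bicolourings \<Lambda> x y))"
      "\<forall>x y. y \<le> x \<longrightarrow> poly2 q (of_nat x) (of_nat y) = of_nat (card (bicolourings \<Lambda> x y))"
    for p q :: "rat poly poly"
    using poly2_eq_0[of "p - q"] that by simp
  ultimately show ?thesis by blast
qed

end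

theory Submission
  imports Defs
begin

text \<open>
  Exchanging the two sums in the definition of the multiorbital polynomial collects, for each
  \<open>g\<close>, one copy of the bichromatic polynomial of \<open>\<Gamma>/g\<close> with weight \<open>1/|H|\<close> for every
  subgroup \<open>H\<close> that contains \<open>g\<close>; these weights add up to the orbital weight of \<open>g\<close>. It
  remains to factor the polynomial of \<open>\<Gamma>/g\<close> (\<open>bichromatic_poly_quotient_graph_union\<close>), for
  which two facts are combined.

  The first is that \<open>\<Gamma>/g\<close> is the disjoint union of \<open>\<Gamma>1/g\<close> and \<open>\<Gamma>2/g\<close>
  (\<open>quotient_graph_union\<close>). Since \<open>G\<close> preserves both vertex sets, no orbit meets both, and
  restriction to a vertex set \<open>W\<close> is a homomorphism from \<open>G\<close> to the automorphism group of the
  graph on \<open>W\<close>. It maps the cyclic group generated by \<open>g\<close> onto the one generated by the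
  restriction of \<open>g\<close>, so that both groups have the same orbits in \<open>W\<close>. The second is that a
  bicolouring of a disjoint union is an independent choice of a bicolouring of each part, so
  that the counts, and hence the polynomials, multiply (\<open>bichromatic_poly_graph_union\<close>).
\<close>

section \<open>Automorphism groups and orbits\<close>

lemma graph_auto_closed:
  assumes "f \<in> graph_auto \<Lambda>" "u \<in> pverts \<Lambda>"
  shows "f u \<in> pverts \<Lambda>"
proof -
  have "f \<in> Bij (pverts \<Lambda>)" using assms(1) by (simp add: graph_auto_def)
  then show ?thesis using Bij_imp_funcset assms(2) by blast
qed

lemma group_GraphAutoGroup: "group (GraphAutoGroup \<Lambda>)"
proof -
  interpret B: group "BijGroup (pverts \<Lambda>)" by (rule group_BijGroup)
  have "subgroup (graph_auto \<Lambda>) (BijGroup (pverts \<Lambda>))"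
  proof (rule B.subgroupI)
    show "graph_auto \<Lambda> \<subseteq> carrier (BijGroup (pverts \<Lambda>))"
      by (auto simp: graph_auto_def BijGroup_def)
    have "(\<lambda>x\<in>pverts \<Lambda>. x) \<in> graph_auto \<Lambda>"
      by (simp add: graph_auto_def id_Bij)
    then show "graph_auto \<Lambda> \<noteq> {}" by blast
  next
    fix f assume f: "f \<in> graph_auto \<Lambda>"
    then have fB: "f \<in> Bij (pverts \<Lambda>)" by (simp add: graph_auto_def)
    let ?i = "inv_into (pverts \<Lambda>) f"
    have mem: "?i u \<in> pverts \<Lambda>" if "u \<in> pverts \<Lambda>" for u
      using Bij_inv_into_mem[OF fB that] .
    have eq: "f (?i u) = u" if "u \<in> pverts \<Lambda>" for u
      using fB that by (auto simp: Bij_def bij_betw_def f_inv_into_f)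
    have "(?i u, ?i v) \<in> parcs \<Lambda> \<longleftrightarrow> (u, v) \<in> parcs \<Lambda>"
      if "u \<in> pverts \<Lambda>" "v \<in> pverts \<Lambda>" for u v
    proof -
      have "(f (?i u), f (?i v)) \<in> parcs \<Lambda> \<longleftrightarrow> (?i u, ?i v) \<in> parcs \<Lambda>"
        using f mem that by (simp add: graph_auto_def)
      then show ?thesis using eq that by simp
    qed
    then show "inv\<^bsub>BijGroup (pverts \<Lambda>)\<^esub> f \<in> graph_auto \<Lambda>"
      using restrict_inv_into_Bij[OF fB] by (simp add: inv_BijGroup[OF fB] graph_auto_def)
  next
    fix f g assume "f \<in> graph_auto \<Lambda>" "g \<in> graph_auto \<Lambda>"
    moreover from this have "g u \<in> pverts \<Lambda>" if "u \<in> pverts \<Lambda>" for u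
      using that by (simp add: graph_auto_closed)
    ultimately show "f \<otimes>\<^bsub>BijGroup (pverts \<Lambda>)\<^esub> g \<in> graph_auto \<Lambda>"
      by (simp add: graph_auto_def BijGroup_def compose_Bij) (simp add: compose_def)
  qed
  then show ?thesis
    unfolding GraphAutoGroup_def by (rule B.subgroup_imp_group)
qed

lemma carrier_GraphAutoGroup [simp]: "carrier (GraphAutoGroup \<Lambda>) = graph_auto \<Lambda>"
  by (simp add: GraphAutoGroup_def)

lemma mult_GraphAutoGroup:
  assumes "f \<in> graph_auto \<Lambda>" "g \<in> graph_auto \<Lambda>"
  shows "f \<otimes>\<^bsub>GraphAutoGroup \<Lambda>\<^esub> g = compose (pverts \<Lambda>) f g"
  using assms by (simp add: GraphAutoGroup_def BijGroup_def graph_auto_def)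

lemma one_GraphAutoGroup: "\<one>\<^bsub>GraphAutoGroup \<Lambda>\<^esub> = restrict (\<lambda>x. x) (pverts \<Lambda>)"
  by (simp add: GraphAutoGroup_def BijGroup_def)

lemma finite_graph_auto:
  assumes "finite (pverts \<Lambda>)"
  shows "finite (graph_auto \<Lambda>)"
proof (rule finite_subset)
  show "graph_auto \<Lambda> \<subseteq> pverts \<Lambda> \<rightarrow>\<^sub>E pverts \<Lambda>"
    by (auto simp: PiE_def graph_auto_closed) (auto simp: graph_auto_def Bij_def)
  show "finite (pverts \<Lambda> \<rightarrow>\<^sub>E pverts \<Lambda>)"
    by (intro finite_PiE assms)
qed

definition cyclic_orbit :: "'a pair_pre_digraph \<Rightarrow> ('a \<Rightarrow> 'a) \<Rightarrow> 'a \<Rightarrow> 'a set"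
  where "cyclic_orbit \<Lambda> g x = (\<lambda>h. h x) ` generate (GraphAutoGroup \<Lambda>) {g}"

lemma cyclic_orbits_eq: "cyclic_orbits \<Lambda> g = cyclic_orbit \<Lambda> g ` pverts \<Lambda>"
  by (auto simp: cyclic_orbits_def orbits_def orbit_def cyclic_orbit_def)

lemma mem_cyclic_orbit_self:
  assumes "x \<in> pverts \<Lambda>"
  shows "x \<in> cyclic_orbit \<Lambda> g x"
  unfolding cyclic_orbit_def
  by (rule image_eqI[OF _ generate.one]) (simp add: one_GraphAutoGroup assms)

lemma cyclic_orbit_subset_pverts:
  assumes "g \<in> graph_auto \<Lambda>" "x \<in> pverts \<Lambda>"
  shows "cyclic_orbit \<Lambda> g x \<subseteq> pverts \<Lambda>"
proof -
  interpret group "GraphAutoGroup \<Lambda>" by (rule group_GraphAutoGroup)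
  have "generate (GraphAutoGroup \<Lambda>) {g} \<subseteq> graph_auto \<Lambda>"
    using generate_incl[of "{g}"] assms by simp
  moreover have "h x \<in> pverts \<Lambda>" if "h \<in> graph_auto \<Lambda>" for h
    using graph_auto_closed[OF that assms(2)] .
  ultimately show ?thesis by (auto simp: cyclic_orbit_def)
qed

section \<open>Restriction to an invariant induced subgraph\<close>

context
  fixes \<Lambda> \<Gamma> :: "'a pair_pre_digraph" and G :: "('a \<Rightarrow> 'a) set"
  assumes finite_verts: "finite (pverts \<Lambda>)"
    and verts_subset: "pverts \<Lambda> \<subseteq> pverts \<Gamma>"
    and induced: "\<And>u v. u \<in> pverts \<Lambda> \<Longrightarrow> v \<in> pverts \<Lambda> \<Longrightarrow>
      (u, v) \<in> parcs \<Lambda> \<longleftrightarrow> (u, v) \<in> parcs \<Gamma>"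
    and subgroup: "subgroup G (GraphAutoGroup \<Gamma>)"
    and invariant: "\<And>g. g \<in> G \<Longrightarrow> g ` pverts \<Lambda> \<subseteq> pverts \<Lambda>"
begin

text \<open>
  Finiteness turns the inclusion \<open>g ` W \<subseteq> W\<close>, for an injective \<open>g\<close>, into the equality
  that a permutation of \<open>W\<close> needs.
\<close>

lemma restrict_mem_graph_auto:
  assumes "g \<in> G"
  shows "restrict g (pverts \<Lambda>) \<in> graph_auto \<Lambda>"
proof -
  have g: "g \<in> graph_auto \<Gamma>" using subgroup.subset[OF subgroup] assms by auto
  then have "inj_on g (pverts \<Lambda>)"
    using verts_subset by (auto simp: graph_auto_def Bij_def bij_betw_def intro: inj_on_subset)
  then have "bij_betw g (pverts \<Lambda>) (pverts \<Lambda>)"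
    using endo_inj_surj[OF finite_verts invariant[OF assms]] by (simp add: bij_betw_def)
  moreover have "(g u, g v) \<in> parcs \<Lambda> \<longleftrightarrow> (u, v) \<in> parcs \<Lambda>"
    if "u \<in> pverts \<Lambda>" "v \<in> pverts \<Lambda>" for u v
  proof -
    have "g u \<in> pverts \<Lambda>" "g v \<in> pverts \<Lambda>" using invariant[OF assms] that by auto
    moreover have "(g u, g v) \<in> parcs \<Gamma> \<longleftrightarrow> (u, v) \<in> parcs \<Gamma>"
      using g verts_subset that by (auto simp: graph_auto_def)
    ultimately show ?thesis using induced that by simp
  qed
  ultimately show ?thesis by (simp add: graph_auto_def Bij_def bij_betw_restrict_eq)
qed

lemma restrict_group_hom:
  "group_hom (GraphAutoGroup \<Gamma> \<lparr>carrier := G\<rparr>) (GraphAutoGroup \<Lambda>)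
    (\<lambda>g. restrict g (pverts \<Lambda>))"
proof -
  have "restrict (g \<otimes>\<^bsub>GraphAutoGroup \<Gamma>\<^esub> h) (pverts \<Lambda>) =
      restrict g (pverts \<Lambda>) \<otimes>\<^bsub>GraphAutoGroup \<Lambda>\<^esub> restrict h (pverts \<Lambda>)"
    if "g \<in> G" "h \<in> G" for g h
  proof -
    have "h x \<in> pverts \<Lambda>" if "x \<in> pverts \<Lambda>" for x using invariant[OF \<open>h \<in> G\<close>] that by auto
    moreover have "g \<in> graph_auto \<Gamma>" "h \<in> graph_auto \<Gamma>"
      using subgroup.subset[OF subgroup] that by auto
    ultimately show ?thesis
      using verts_subset that
      by (auto simp: mult_GraphAutoGroup restrict_mem_graph_auto compose_def fun_eq_iff)
  qed
  then show ?thesis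
    using subgroup.subgroup_is_group[OF subgroup group_GraphAutoGroup]
    by (simp add: group_hom_def group_hom_axioms_def group_GraphAutoGroup hom_def
        restrict_mem_graph_auto)
qed

text \<open>
  A homomorphism maps the subgroup generated by \<open>g\<close> onto the subgroup generated by the image
  of \<open>g\<close>, and restricting an automorphism does not change its value at \<open>x\<close>.
\<close>

lemma cyclic_orbit_restrict:
  assumes "g \<in> G" "x \<in> pverts \<Lambda>"
  shows "cyclic_orbit \<Lambda> (restrict g (pverts \<Lambda>)) x = cyclic_orbit \<Gamma> g x"
proof -
  interpret \<Gamma>: group "GraphAutoGroup \<Gamma>" by (rule group_GraphAutoGroup)
  interpret group_hom "GraphAutoGroup \<Gamma> \<lparr>carrier := G\<rparr>" "GraphAutoGroup \<Lambda>"
    "\<lambda>g. restrict g (pverts \<Lambda>)"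
    by (rule restrict_group_hom)
  have "generate (GraphAutoGroup \<Lambda>) {restrict g (pverts \<Lambda>)} =
      (\<lambda>g. restrict g (pverts \<Lambda>)) ` generate (GraphAutoGroup \<Gamma>) {g}"
    using generate_img[of "{g}"] \<Gamma>.generate_consistent[OF _ subgroup, of "{g}"] assms(1) by simp
  then show ?thesis using assms(2) by (simp add: cyclic_orbit_def image_image)
qed

end

section \<open>Quotients of disjoint unions\<close>

lemma graph_union_simps [simp]:
  "pverts (graph_union \<Gamma>1 \<Gamma>2) = pverts \<Gamma>1 \<union> pverts \<Gamma>2"
  "parcs (graph_union \<Gamma>1 \<Gamma>2) = parcs \<Gamma>1 \<union> parcs \<Gamma>2"
  by (simp_all add: graph_union_def)

lemma pair_wf_digraph_arcD:
  assumes "pair_wf_digraph \<Lambda>" "(u, v) \<in> parcs \<Lambda>"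
  shows "u \<in> pverts \<Lambda>" "v \<in> pverts \<Lambda>"
  using pair_wf_digraph.arc_fst_in_verts[OF assms] pair_wf_digraph.arc_snd_in_verts[OF assms]
  by simp_all

lemma pair_pseudo_graph_iff:
  "pair_pseudo_graph \<Lambda> \<longleftrightarrow>
    finite (pverts \<Lambda>) \<and> parcs \<Lambda> \<subseteq> pverts \<Lambda> \<times> pverts \<Lambda> \<and> sym (parcs \<Lambda>)"
proof
  assume "pair_pseudo_graph \<Lambda>"
  then interpret pair_pseudo_graph \<Lambda> .
  show "finite (pverts \<Lambda>) \<and> parcs \<Lambda> \<subseteq> pverts \<Lambda> \<times> pverts \<Lambda> \<and> sym (parcs \<Lambda>)"
    using pair_finite_verts pair_wf_digraph_arcD[OF pair_wf_digraph_axioms] arcs_symmetric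
    by (auto simp: sym_def)
next
  assume R: "finite (pverts \<Lambda>) \<and> parcs \<Lambda> \<subseteq> pverts \<Lambda> \<times> pverts \<Lambda> \<and> sym (parcs \<Lambda>)"
  then have "finite (parcs \<Lambda>)" by (meson finite_SigmaI finite_subset)
  with R show "pair_pseudo_graph \<Lambda>"
    by unfold_locales (auto simp: symmetric_def)
qed

lemma pair_pseudo_graph_quotient:
  assumes "pair_pseudo_graph \<Lambda>"
  shows "pair_pseudo_graph (quotient_graph \<Lambda> g)"
  using assms
  by (auto simp: pair_pseudo_graph_iff quotient_graph_def cyclic_orbits_eq intro!: symI)
    (blast dest: symD)

lemma pair_pseudo_graph_union:
  assumes "pair_pseudo_graph \<Gamma>1" "pair_pseudo_graph \<Gamma>2"
  shows "pair_pseudo_graph (graph_union \<Gamma>1 \<Gamma>2)"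
  using assms by (auto simp: pair_pseudo_graph_iff intro: sym_Un)

context
  fixes \<Gamma>1 \<Gamma>2 :: "'a pair_pre_digraph" and G :: "('a \<Rightarrow> 'a) set" and g :: "'a \<Rightarrow> 'a"
  assumes graphs: "pair_pseudo_graph \<Gamma>1" "pair_pseudo_graph \<Gamma>2"
    and disjoint: "pverts \<Gamma>1 \<inter> pverts \<Gamma>2 = {}"
    and subgroup: "subgroup G (GraphAutoGroup (graph_union \<Gamma>1 \<Gamma>2))"
    and invariant: "\<And>g. g \<in> G \<Longrightarrow> g ` pverts \<Gamma>1 \<subseteq> pverts \<Gamma>1"
      "\<And>g. g \<in> G \<Longrightarrow> g ` pverts \<Gamma>2 \<subseteq> pverts \<Gamma>2"
    and g: "g \<in> G"
begin

private abbreviation (input) "g1 \<equiv> restrict g (pverts \<Gamma>1)"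
private abbreviation (input) "g2 \<equiv> restrict g (pverts \<Gamma>2)"

private lemma arcs: "parcs \<Gamma>1 \<subseteq> pverts \<Gamma>1 \<times> pverts \<Gamma>1" "parcs \<Gamma>2 \<subseteq> pverts \<Gamma>2 \<times> pverts \<Gamma>2"
  using graphs by (simp_all add: pair_pseudo_graph_iff)

private lemma finite: "finite (pverts \<Gamma>1)" "finite (pverts \<Gamma>2)"
  using graphs by (simp_all add: pair_pseudo_graph_iff)

private lemma induced1:
  assumes "u \<in> pverts \<Gamma>1" "v \<in> pverts \<Gamma>1"
  shows "(u, v) \<in> parcs \<Gamma>1 \<longleftrightarrow> (u, v) \<in> parcs (graph_union \<Gamma>1 \<Gamma>2)"
  using assms arcs disjoint by auto

private lemma induced2:
  assumes "u \<in> pverts \<Gamma>2" "v \<in> pverts \<Gamma>2"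
  shows "(u, v) \<in> parcs \<Gamma>2 \<longleftrightarrow> (u, v) \<in> parcs (graph_union \<Gamma>1 \<Gamma>2)"
  using assms arcs disjoint by auto

private lemma orbits_subset:
  "A \<in> cyclic_orbits \<Gamma>1 g1 \<Longrightarrow> A \<subseteq> pverts \<Gamma>1"
  "A \<in> cyclic_orbits \<Gamma>2 g2 \<Longrightarrow> A \<subseteq> pverts \<Gamma>2"
  using
    cyclic_orbit_subset_pverts[OF restrict_mem_graph_auto[OF finite(1) _ induced1 subgroup
      invariant(1) g]]
    cyclic_orbit_subset_pverts[OF restrict_mem_graph_auto[OF finite(2) _ induced2 subgroup
      invariant(2) g]]
  by (auto simp: cyclic_orbits_eq)

private lemma orbits_union:
  "cyclic_orbits (graph_union \<Gamma>1 \<Gamma>2) g = cyclic_orbits \<Gamma>1 g1 \<union> cyclic_orbits \<Gamma>2 g2"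
proof -
  have "cyclic_orbit \<Gamma>1 g1 ` pverts \<Gamma>1 = cyclic_orbit (graph_union \<Gamma>1 \<Gamma>2) g ` pverts \<Gamma>1"
    using cyclic_orbit_restrict[OF finite(1) _ induced1 subgroup invariant(1) g]
    by (intro image_cong) auto
  moreover have
    "cyclic_orbit \<Gamma>2 g2 ` pverts \<Gamma>2 = cyclic_orbit (graph_union \<Gamma>1 \<Gamma>2) g ` pverts \<Gamma>2"
    using cyclic_orbit_restrict[OF finite(2) _ induced2 subgroup invariant(2) g]
    by (intro image_cong) auto
  ultimately show ?thesis by (simp add: cyclic_orbits_eq image_Un)
qed

lemma quotient_graph_disjoint:
  "pverts (quotient_graph \<Gamma>1 g1) \<inter> pverts (quotient_graph \<Gamma>2 g2) = {}"
proof -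
  have "A \<noteq> {}" if "A \<in> cyclic_orbits \<Gamma>1 g1" for A
    using that mem_cyclic_orbit_self by (fastforce simp: cyclic_orbits_eq)
  then show ?thesis
    using orbits_subset disjoint by (fastforce simp: quotient_graph_def)
qed

text \<open>
  An arc of \<open>\<Gamma>1\<close> between two orbits forces both orbits to lie in the vertex set of \<open>\<Gamma>1\<close>,
  since an orbit is contained in one of the two vertex sets; likewise for \<open>\<Gamma>2\<close>.
\<close>

lemma quotient_graph_union:
  "quotient_graph (graph_union \<Gamma>1 \<Gamma>2) g =
    graph_union (quotient_graph \<Gamma>1 g1) (quotient_graph \<Gamma>2 g2)"
proof -
  have 1: "A \<in> cyclic_orbits \<Gamma>1 g1"
    if "A \<in> cyclic_orbits \<Gamma>1 g1 \<union> cyclic_orbits \<Gamma>2 g2" "u \<in> A" "u \<in> pverts \<Gamma>1" for A u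
    using that orbits_subset disjoint by blast
  have 2: "A \<in> cyclic_orbits \<Gamma>2 g2"
    if "A \<in> cyclic_orbits \<Gamma>1 g1 \<union> cyclic_orbits \<Gamma>2 g2" "u \<in> A" "u \<in> pverts \<Gamma>2" for A u
    using that orbits_subset disjoint by blast
  have "{(A, B). A \<in> cyclic_orbits \<Gamma>1 g1 \<union> cyclic_orbits \<Gamma>2 g2 \<and>
      B \<in> cyclic_orbits \<Gamma>1 g1 \<union> cyclic_orbits \<Gamma>2 g2 \<and>
      (\<exists>u\<in>A. \<exists>v\<in>B. (u, v) \<in> parcs \<Gamma>1 \<union> parcs \<Gamma>2)} =
    {(A, B). A \<in> cyclic_orbits \<Gamma>1 g1 \<and> B \<in> cyclic_orbits \<Gamma>1 g1 \<and>
      (\<exists>u\<in>A. \<exists>v\<in>B. (u, v) \<in> parcs \<Gamma>1)} \<union>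
    {(A, B). A \<in> cyclic_orbits \<Gamma>2 g2 \<and> B \<in> cyclic_orbits \<Gamma>2 g2 \<and>
      (\<exists>u\<in>A. \<exists>v\<in>B. (u, v) \<in> parcs \<Gamma>2)}" (is "?L = ?R")
  proof
    show "?L \<subseteq> ?R"
    proof (rule subrelI)
      fix A B assume "(A, B) \<in> ?L"
      then obtain u v where AB: "A \<in> cyclic_orbits \<Gamma>1 g1 \<union> cyclic_orbits \<Gamma>2 g2"
          "B \<in> cyclic_orbits \<Gamma>1 g1 \<union> cyclic_orbits \<Gamma>2 g2" "u \<in> A" "v \<in> B"
        and "(u, v) \<in> parcs \<Gamma>1 \<union> parcs \<Gamma>2" by blast
      from this(5) show "(A, B) \<in> ?R"
      proof
        assume uv: "(u, v) \<in> parcs \<Gamma>1"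
        then have "u \<in> pverts \<Gamma>1" "v \<in> pverts \<Gamma>1" using arcs by auto
        then show ?thesis using 1[OF AB(1,3)] 1[OF AB(2,4)] AB(3,4) uv by blast
      next
        assume uv: "(u, v) \<in> parcs \<Gamma>2"
        then have "u \<in> pverts \<Gamma>2" "v \<in> pverts \<Gamma>2" using arcs by auto
        then show ?thesis using 2[OF AB(1,3)] 2[OF AB(2,4)] AB(3,4) uv by blast
      qed
    qed
  qed auto
  then show ?thesis
    by (simp only: quotient_graph_def orbits_union graph_union_simps) (simp add: graph_union_def)
qed

end

section \<open>Bichromatic polynomials of disjoint unions\<close>

lemma poly2_bichromatic_poly:
  assumes "pair_pseudo_graph \<Lambda>" "y \<le> x"
  shows "poly2 (bichromatic_poly \<Lambda>) (of_nat x) (of_nat y) = of_nat (card (bicolourings \<Lambda> x y))"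
  using theI'[OF bichromatic_poly_unique_existence[OF assms(1)]] assms(2)
  by (simp add: bichromatic_poly_def)

text \<open>
  No arc joins the two parts, so the condition on a colouring is a condition on each of its
  two restrictions; conversely, any two colourings of the parts can be glued.
\<close>

lemma card_bicolourings_graph_union:
  assumes "parcs \<Gamma>1 \<subseteq> pverts \<Gamma>1 \<times> pverts \<Gamma>1" "parcs \<Gamma>2 \<subseteq> pverts \<Gamma>2 \<times> pverts \<Gamma>2"
    and "pverts \<Gamma>1 \<inter> pverts \<Gamma>2 = {}"
  shows "card (bicolourings (graph_union \<Gamma>1 \<Gamma>2) x y) =
    card (bicolourings \<Gamma>1 x y) * card (bicolourings \<Gamma>2 x y)"
proof -
  let ?V1 = "pverts \<Gamma>1" and ?V2 = "pverts \<Gamma>2"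
  let ?split = "\<lambda>c. (restrict c ?V1, restrict c ?V2)"
  let ?glue = "\<lambda>p. \<lambda>v\<in>?V1 \<union> ?V2. if v \<in> ?V1 then fst p v else snd p v"
  have "bij_betw ?split (bicolourings (graph_union \<Gamma>1 \<Gamma>2) x y)
      (bicolourings \<Gamma>1 x y \<times> bicolourings \<Gamma>2 x y)"
  proof (rule bij_betw_byWitness[where f' = ?glue])
    show "\<forall>c\<in>bicolourings (graph_union \<Gamma>1 \<Gamma>2) x y. ?glue (?split c) = c"
      by (auto simp: bicolourings_def fun_eq_iff PiE_iff extensional_def)
    show "\<forall>p\<in>bicolourings \<Gamma>1 x y \<times> bicolourings \<Gamma>2 x y. ?split (?glue p) = p"
      using assms(3) by (auto simp: bicolourings_def fun_eq_iff PiE_iff extensional_def)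
    show "?split ` bicolourings (graph_union \<Gamma>1 \<Gamma>2) x y \<subseteq>
        bicolourings \<Gamma>1 x y \<times> bicolourings \<Gamma>2 x y"
      using assms(1,2) by (fastforce simp: bicolourings_def)
    show "?glue ` (bicolourings \<Gamma>1 x y \<times> bicolourings \<Gamma>2 x y) \<subseteq>
        bicolourings (graph_union \<Gamma>1 \<Gamma>2) x y"
    proof (rule image_subsetI)
      fix p assume "p \<in> bicolourings \<Gamma>1 x y \<times> bicolourings \<Gamma>2 x y"
      then have c: "fst p \<in> bicolourings \<Gamma>1 x y" "snd p \<in> bicolourings \<Gamma>2 x y" by auto
      let ?c = "?glue p"
      have 1: "?c v = fst p v" if "v \<in> ?V1" for v using that by simp
      have 2: "?c v = snd p v" if "v \<in> ?V2" for v using that assms(3) by auto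
      have "?c \<in> ?V1 \<union> ?V2 \<rightarrow>\<^sub>E {1..x}" using c by (fastforce simp: bicolourings_def)
      moreover have "y < ?c u" if "(u, v) \<in> parcs \<Gamma>1" "?c u = ?c v" for u v
      proof -
        have "u \<in> ?V1" "v \<in> ?V1" using that(1) assms(1) by auto
        moreover from this have "fst p u = fst p v" using that(2) by (simp only: 1)
        ultimately show ?thesis using c(1) that(1) 1 by (fastforce simp: bicolourings_def)
      qed
      moreover have "y < ?c u" if "(u, v) \<in> parcs \<Gamma>2" "?c u = ?c v" for u v
      proof -
        have "u \<in> ?V2" "v \<in> ?V2" using that(1) assms(2) by auto
        moreover from this have "snd p u = snd p v" using that(2) by (simp only: 2)
        ultimately show ?thesis using c(2) that(1) 2 by (fastforce simp: bicolourings_def)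
      qed
      ultimately show "?c \<in> bicolourings (graph_union \<Gamma>1 \<Gamma>2) x y"
        unfolding bicolourings_def graph_union_simps by (auto simp del: restrict_apply)
    qed
  qed
  then show ?thesis by (simp add: bij_betw_same_card card_cartesian_product)
qed

text \<open>
  The counts multiply at all natural numbers \<open>x \<ge> y\<close>, and these values determine a bivariate
  polynomial.
\<close>

lemma bichromatic_poly_graph_union:
  assumes "pair_pseudo_graph \<Gamma>1" "pair_pseudo_graph \<Gamma>2" "pverts \<Gamma>1 \<inter> pverts \<Gamma>2 = {}"
  shows "bichromatic_poly (graph_union \<Gamma>1 \<Gamma>2) = bichromatic_poly \<Gamma>1 * bichromatic_poly \<Gamma>2"
proof -
  have "bichromatic_poly (graph_union \<Gamma>1 \<Gamma>2) - bichromatic_poly \<Gamma>1 * bichromatic_poly \<Gamma>2 = 0"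
    using card_bicolourings_graph_union[OF _ _ assms(3)] assms(1,2)[unfolded pair_pseudo_graph_iff]
    by (intro poly2_eq_0)
      (simp add: poly2_bichromatic_poly[OF assms(1)] poly2_bichromatic_poly[OF assms(2)]
        poly2_bichromatic_poly[OF pair_pseudo_graph_union[OF assms(1,2)]])
  then show ?thesis by simp
qed

lemma bichromatic_poly_quotient_graph_union:
  assumes "pair_pseudo_graph \<Gamma>1" "pair_pseudo_graph \<Gamma>2"
    and "pverts \<Gamma>1 \<inter> pverts \<Gamma>2 = {}"
    and "subgroup G (GraphAutoGroup (graph_union \<Gamma>1 \<Gamma>2))"
    and "\<And>g. g \<in> G \<Longrightarrow> g ` pverts \<Gamma>1 \<subseteq> pverts \<Gamma>1"
    and "\<And>g. g \<in> G \<Longrightarrow> g ` pverts \<Gamma>2 \<subseteq> pverts \<Gamma>2"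
    and "g \<in> G"
  shows "bichromatic_poly (quotient_graph (graph_union \<Gamma>1 \<Gamma>2) g) =
    bichromatic_poly (quotient_graph \<Gamma>1 (restrict g (pverts \<Gamma>1))) *
    bichromatic_poly (quotient_graph \<Gamma>2 (restrict g (pverts \<Gamma>2)))"
proof -
  let ?Q1 = "quotient_graph \<Gamma>1 (restrict g (pverts \<Gamma>1))"
  let ?Q2 = "quotient_graph \<Gamma>2 (restrict g (pverts \<Gamma>2))"
  have "quotient_graph (graph_union \<Gamma>1 \<Gamma>2) g = graph_union ?Q1 ?Q2"
    by (rule quotient_graph_union[OF assms])
  moreover have "pverts ?Q1 \<inter> pverts ?Q2 = {}"
    by (rule quotient_graph_disjoint[OF assms])
  ultimately show ?thesis
    by (simp only: bichromatic_poly_graph_union pair_pseudo_graph_quotient assms(1,2))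
qed

section \<open>Exchanging the sums over subgroups and elements\<close>

lemma multiorbital_bichromatic_poly_eq_sum_orbital_weight:
  assumes "finite G"
  shows "multiorbital_bichromatic_poly \<Gamma> G =
    (\<Sum>g\<in>G. smult [:orbital_weight \<Gamma> G g:] (bichromatic_poly (quotient_graph \<Gamma> g)))"
proof -
  let ?S = "{H. subgroup H (GraphAutoGroup \<Gamma> \<lparr>carrier := G\<rparr>)}"
  let ?P = "\<lambda>h. bichromatic_poly (quotient_graph \<Gamma> h)"
  let ?w = "\<lambda>H. [:1 / of_nat (card H) :: rat:]"
  have sub: "H \<subseteq> G" if "H \<in> ?S" for H using subgroup.subset that by fastforce
  then have fin: "finite ?S" by (intro finite_subset[OF _ finite_Pow_iff[THEN iffD2, OF assms]]) auto
  have const: "[:\<Sum>H\<in>A. f H:] = (\<Sum>H\<in>A. [:f H:])" for A and f :: "('a \<Rightarrow> 'a) set \<Rightarrow> rat"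
    by (rule poly_eqI) (simp add: coeff_sum coeff_pCons split: nat.split)
  have "multiorbital_bichromatic_poly \<Gamma> G = (\<Sum>H\<in>?S. \<Sum>h\<in>{h. h \<in> G \<and> h \<in> H}. smult (?w H) (?P h))"
    unfolding multiorbital_bichromatic_poly_def
  proof (rule sum.cong[OF refl])
    fix H assume "H \<in> ?S"
    then have "{h. h \<in> G \<and> h \<in> H} = H" using sub by auto
    then show "smult (?w H) (\<Sum>h\<in>H. ?P h) = (\<Sum>h\<in>{h. h \<in> G \<and> h \<in> H}. smult (?w H) (?P h))"
      by (intro poly_eqI) (simp add: coeff_sum sum_distrib_left)
  qed
  also have "\<dots> = (\<Sum>h\<in>G. \<Sum>H\<in>{H. H \<in> ?S \<and> h \<in> H}. smult (?w H) (?P h))"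
    by (rule sum.swap_restrict[OF fin assms])
  also have "\<dots> = (\<Sum>g\<in>G. smult [:orbital_weight \<Gamma> G g:] (?P g))"
    by (simp add: orbital_weight_def const smult_sum)
  finally show ?thesis .
qed

theorem proposition3p8:
  fixes \<Gamma>1 \<Gamma>2 :: "'a pair_pre_digraph" and G :: "('a \<Rightarrow> 'a) set"
  assumes "pair_pseudo_graph \<Gamma>1" and "pair_pseudo_graph \<Gamma>2"
    and "pverts \<Gamma>1 \<inter> pverts \<Gamma>2 = {}"
    and "subgroup G (GraphAutoGroup (graph_union \<Gamma>1 \<Gamma>2))"
    and "\<And>g. g \<in> G \<Longrightarrow> g ` pverts \<Gamma>1 \<subseteq> pverts \<Gamma>1"
    and "\<And>g. g \<in> G \<Longrightarrow> g ` pverts \<Gamma>2 \<subseteq> pverts \<Gamma>2"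
  shows "multiorbital_bichromatic_poly (graph_union \<Gamma>1 \<Gamma>2) G =
    (\<Sum>g\<in>G. smult [:orbital_weight (graph_union \<Gamma>1 \<Gamma>2) G g:]
      (bichromatic_poly (quotient_graph \<Gamma>1 (restrict g (pverts \<Gamma>1))) *
       bichromatic_poly (quotient_graph \<Gamma>2 (restrict g (pverts \<Gamma>2)))))"
proof -
  have "finite (graph_auto (graph_union \<Gamma>1 \<Gamma>2))"
    using assms(1,2) by (intro finite_graph_auto) (simp add: pair_pseudo_graph_iff)
  then have "finite G"
    using subgroup.subset[OF assms(4)] by (auto intro: finite_subset)
  then show ?thesis
    by (simp add: multiorbital_bichromatic_poly_eq_sum_orbital_weight
        bichromatic_poly_quotient_graph_union[OF assms])
qed

end
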